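(* Let $n\ge 1$, let $X_1,\ldots,X_n$ be independent random variables taking values in some set $\mathcal{X}$, let $X=(X_1,\ldots,X_n)$, let $X'=(X'_1,\ldots,X'_n)$ be an independent copy of $X$, and let $f:\mathcal{X}^n\to\mathbb{R}$ be a measurable function. Let $\sigma=(\sigma(1),\ldots,\sigma(n))$ be a random permutation sampled uniformly from the symmetric group $S_n$, independent of $(X,X')$. For $i\in[n]$ denote $$B_i=\mathbb{E}\left[\left(f(X)-f(X^{(\sigma(i))})\right)\left(f(X^{\sigma([i-1])})-f(X^{\sigma([i])})\right)\right],$$ where the expectation is taken with respect to $X$, $X'$ and the random permutation $\sigma$. Then $B_i\ge B_{i+1}$ for all $i=1,\ldots,n-1$, and $B_n\ge 0$. In particular, for any $k\in[n]$, $$B_k\le\frac{2\,\mathrm{Var}(f(X))}{k}.$$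
   Context: Notation: $[i]=\{1,\ldots,i\}$, $[0]=\emptyset$, and $\sigma([i])=\{\sigma(1),\ldots,\sigma(i)\}$. For $A\subseteq[n]$, $X^A$ denotes the vector obtained from $X$ by replacing the components indexed by $A$ by the corresponding components of $X'$ (so $X^{\emptyset}=X$). For $i\in[n]$, $X^{(i)}=(X_1,\ldots,X_{i-1},X'_i,X_{i+1},\ldots,X_n)$. *)

theory Defs
  imports "HOL-Probability.Probability" "HOL-Combinatorics.Permutations"
begin

text \<open>A point of \<open>\<X>\<^sup>n\<close> is an extensional function on \<open>{1..n}\<close>, i.e. an element of
  \<open>space (\<Pi>\<^sub>M i\<in>{1..n}. E)\<close> when \<open>E\<close> is the measurable space on \<open>\<X>\<close>.\<close>

definition rvec :: "nat \<Rightarrow> (nat \<Rightarrow> 'a \<Rightarrow> 'b) \<Rightarrow> 'a \<Rightarrow> nat \<Rightarrow> 'b" where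
  "rvec n X \<omega> = (\<lambda>i\<in>{1..n}. X i \<omega>)"

context prob_space
begin

text \<open>\<^const>\<open>indep_var\<close> forces both random variables to have the same HOL value type. The
  following is the same condition without that restriction.\<close>

definition indep_rv :: "'b measure \<Rightarrow> ('a \<Rightarrow> 'b) \<Rightarrow> 'c measure \<Rightarrow> ('a \<Rightarrow> 'c) \<Rightarrow> bool" where
  "indep_rv S X T Y \<longleftrightarrow>
    random_variable S X \<and> random_variable T Y \<and>
    indep_set
      (sigma_sets (space M) {X -` A \<inter> space M | A. A \<in> sets S})
      (sigma_sets (space M) {Y -` A \<inter> space M | A. A \<in> sets T})"

lemma indep_rv_eq_indep_var: "indep_rv S X T Y \<longleftrightarrow> indep_var S X T Y"
  by (simp add: indep_rv_def indep_var_eq)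

definition indep_copy :: "'b measure \<Rightarrow> ('a \<Rightarrow> 'b) \<Rightarrow> ('a \<Rightarrow> 'b) \<Rightarrow> bool" where
  "indep_copy S X X' \<longleftrightarrow> indep_var S X S X' \<and> distr M S X' = distr M S X"

definition uniform_permutation :: "nat \<Rightarrow> ('a \<Rightarrow> nat \<Rightarrow> nat) \<Rightarrow> bool" where
  "uniform_permutation n \<sigma> \<longleftrightarrow>
    random_variable (count_space {p. p permutes {1..n}}) \<sigma> \<and>
    distr M (count_space {p. p permutes {1..n}}) \<sigma> = uniform_count_measure {p. p permutes {1..n}}"

text \<open>Here \<open>X\<^bsup>A\<^esup>\<close> is \<^term>\<open>override_on x x' A\<close> and \<open>X\<^bsup>(j)\<^esup>\<close> is \<^term>\<open>x(j := x' j)\<close>, where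
  \<open>x\<close> and \<open>x'\<close> are the values of the random vectors \<open>X\<close> and \<open>X'\<close>.\<close>

definition B ::
  "nat \<Rightarrow> (nat \<Rightarrow> 'a \<Rightarrow> 'b) \<Rightarrow> (nat \<Rightarrow> 'a \<Rightarrow> 'b) \<Rightarrow> ('a \<Rightarrow> nat \<Rightarrow> nat) \<Rightarrow> ((nat \<Rightarrow> 'b) \<Rightarrow> real) \<Rightarrow> nat \<Rightarrow> real"
where
  "B n X X' \<sigma> f i = expectation (\<lambda>\<omega>.
     let x = rvec n X \<omega>; x' = rvec n X' \<omega>; s = \<sigma> \<omega> in
       (f x - f (x(s i := x' (s i)))) *
       (f (override_on x x' (s ` {1..i - 1})) - f (override_on x x' (s ` {1..i}))))"

end

end

theory Submission
  imports Defs
begin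

text \<open>
  Write \<open>\<phi>(A) = E[f(X) f(X\<^sup>A)]\<close>. As \<open>(X, X')\<close> keeps its law when any of the pairs \<open>X\<^sub>i, X'\<^sub>i\<close> are
  interchanged, \<open>E[f(X\<^sup>S) f(X\<^sup>T)]\<close> is \<open>\<phi>\<close> of the symmetric difference of \<open>S\<close> and \<open>T\<close>. Expanding the
  product, for \<open>j \<notin> A\<close>,
  \<open>E[(f(X) - f(X\<^sup>{\<^sup>j\<^sup>})) (f(X\<^sup>A) - f(X\<^sup>A\<^sup>\<union>\<^sup>{\<^sup>j\<^sup>}))] = 2 (\<phi>(A) - \<phi>(A \<union> {j}))\<close>.
  Averaging over the permutation gives \<open>B\<^sub>i = 2 (a\<^sub>i\<^sub>-\<^sub>1 - a\<^sub>i)\<close>, where \<open>a\<^sub>k\<close> is the mean of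
  \<open>\<phi>(\<sigma>([k]))\<close>. The \<open>B\<^sub>i\<close> therefore telescope: \<open>B\<^sub>1 + \<dots> + B\<^sub>n = 2 (\<phi>({}) - \<phi>([n])) = 2 Var(f(X))\<close>.
  All that remains is that \<open>a\<close> is decreasing and convex.

  Both properties hold already for the set function \<open>\<phi>\<close>: it decreases when \<open>A\<close> grows
  (\<open>corr_insert_le\<close>), and
  \<open>\<phi>(A) - \<phi>(A \<union> {i}) - \<phi>(A \<union> {j}) + \<phi>(A \<union> {i, j}) \<ge> 0\<close> (\<open>corr_convex\<close>). Up to a factor these
  numbers are \<open>E[u u\<^sup>A]\<close>, with \<open>u\<close> a first or second difference of \<open>f\<close> in the coordinates \<open>i, j\<close> and
  \<open>u\<^sup>A\<close> the same difference after resampling \<open>A\<close>. Replacing the coordinates in \<open>A\<close> by fresh copies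
  again and again produces an infinite exchangeable sequence of square integrable variables. The
  mean product of two terms of such a sequence cannot be negative, because then long sums would have
  a negative second moment (\<open>corr_quadratic_form_nonneg\<close>). Convexity of \<open>\<phi>\<close> passes to \<open>a\<close> since
  \<open>\<sigma>(k + 1)\<close> and \<open>\<sigma>(k + 2)\<close> are exchangeable given \<open>\<sigma>([k])\<close> (\<open>prefix_mean_convex\<close>).
\<close>

section \<open>Correlations of a function under resampling\<close>

locale resampling =
  fixes I :: "'i set" and N :: "'i \<Rightarrow> 'b measure" and f :: "('i \<Rightarrow> 'b) \<Rightarrow> real"
  assumes prob_N: "\<And>i. i \<in> I \<Longrightarrow> prob_space (N i)"
    and f_measurable: "f \<in> borel_measurable (PiM I N)"
    and f_square_integrable: "integrable (PiM I N) (\<lambda>x. (f x)\<^sup>2)"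
begin

text \<open>Infinitely many independent copies of every coordinate: copies 0 and 1 stand for \<open>X\<close> and
  \<open>X'\<close>, and the exchangeability argument resamples a coordinate by running through all of them. A choice \<open>c\<close> of one copy per
  coordinate assembles a vector whose law is again the product measure, so \<open>indicator A\<close> selects
  \<open>X\<^sup>A\<close>.\<close>

definition copies :: "('i \<times> nat \<Rightarrow> 'b) measure" where
  "copies = (\<Pi>\<^sub>M k \<in> I \<times> UNIV. N (fst k))"

definition pick :: "('i \<Rightarrow> nat) \<Rightarrow> ('i \<times> nat \<Rightarrow> 'b) \<Rightarrow> 'i \<Rightarrow> 'b" where
  "pick c z = (\<lambda>i\<in>I. z (i, c i))"

text \<open>The function \<open>\<phi>(A) = E[f(X) f(X\<^sup>A)]\<close>; \<open>indicator {}\<close> rather than \<open>\<lambda>_. 0\<close> makes \<open>X\<close> an instance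
  of \<open>X\<^sup>A\<close>.\<close>

definition corr :: "'i set \<Rightarrow> real" where
  "corr A = (\<integral>z. f (pick (indicator {}) z) * f (pick (indicator A) z) \<partial>copies)"

lemma distr_pick: "distr copies (PiM I N) (pick c) = PiM I N"
  using distr_PiM_reindex[of "I \<times> UNIV" "\<lambda>k. N (fst k)" "\<lambda>i. (i, c i)" I] prob_N
  unfolding copies_def pick_def by (auto simp: inj_on_def)

lemma measurable_pick [measurable]: "pick c \<in> copies \<rightarrow>\<^sub>M PiM I N"
proof -
  have "(\<lambda>z. z (i, c i)) \<in> copies \<rightarrow>\<^sub>M N i" if "i \<in> I" for i
    using measurable_component_singleton[of "(i, c i)" "I \<times> UNIV" "\<lambda>k. N (fst k)"] that
    by (simp add: copies_def)
  then show ?thesis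
    unfolding pick_def by (rule measurable_restrict)
qed

lemma measurable_f_pick [measurable]: "(\<lambda>z. f (pick c z)) \<in> borel_measurable copies"
  using measurable_compose[OF measurable_pick f_measurable] .

lemma integrable_pick_square: "integrable copies (\<lambda>z. (f (pick c z))\<^sup>2)"
proof -
  have "integrable (distr copies (PiM I N) (pick c)) (\<lambda>x. (f x)\<^sup>2)"
    using f_square_integrable by (simp add: distr_pick)
  then show ?thesis
    using f_measurable by (subst (asm) integrable_distr_eq) auto
qed

lemma integrable_pick_mult: "integrable copies (\<lambda>z. f (pick c z) * f (pick d z))"
proof (rule Bochner_Integration.integrable_bound)
  show "integrable copies (\<lambda>z. (f (pick c z))\<^sup>2 + (f (pick d z))\<^sup>2)"
    by (intro Bochner_Integration.integrable_add integrable_pick_square)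
  have "\<bar>a * b\<bar> \<le> a\<^sup>2 + b\<^sup>2" for a b :: real
  proof -
    have "2 * (\<bar>a\<bar> * \<bar>b\<bar>) \<le> a\<^sup>2 + b\<^sup>2"
      using sum_squares_bound[of "\<bar>a\<bar>" "\<bar>b\<bar>"] by (simp add: mult.assoc)
    moreover have "0 \<le> \<bar>a\<bar> * \<bar>b\<bar>"
      by simp
    ultimately show ?thesis
      unfolding abs_mult by linarith
  qed
  then show "AE z in copies. norm (f (pick c z) * f (pick d z))
      \<le> norm ((f (pick c z))\<^sup>2 + (f (pick d z))\<^sup>2)"
    by auto
qed measurable

text \<open>The copies of one coordinate are interchangeable, so only the places where two choices disagree
  matter.\<close>

lemma integral_pick_mult:
  "(\<integral>z. f (pick c z) * f (pick d z) \<partial>copies) = corr {i \<in> I. c i \<noteq> d i}"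
proof -
  \<comment> \<open>An injective renaming that takes copy 0 to \<open>c i\<close> and, if \<open>c\<close> and \<open>d\<close> disagree at \<open>i\<close>, copy 1
    to \<open>d i\<close>. The remaining copies go to pairwise distinct numbers above \<open>c i\<close> and \<open>d i\<close>.\<close>
  define t :: "'i \<times> nat \<Rightarrow> 'i \<times> nat" where
    "t = (\<lambda>(i, m). (i, if m = 0 then c i else if m = 1 \<and> c i \<noteq> d i then d i else m + c i + d i))"
  define R where "R z = (\<lambda>k\<in>I \<times> UNIV. z (t k))" for z :: "'i \<times> nat \<Rightarrow> 'b"
  have "inj t"
    by (auto simp: inj_on_def t_def split: if_splits)
  moreover have fst_t: "fst (t k) = fst k" for k
    by (simp add: t_def split: prod.split)
  ultimately have R: "distr copies copies R = copies"
    using distr_PiM_reindex[of "I \<times> UNIV" "\<lambda>k. N (fst k)" t "I \<times> UNIV"] prob_N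
    unfolding copies_def R_def by (auto simp: inj_on_def mem_Times_iff Pi_iff)
  have R_measurable: "R \<in> copies \<rightarrow>\<^sub>M copies"
    unfolding copies_def R_def by (rule measurable_restrict, subst fst_t[symmetric],
        rule measurable_component_singleton) (auto simp: mem_Times_iff fst_t)
  have "corr {i \<in> I. c i \<noteq> d i} = (\<integral>z. f (pick (indicator {}) z) * f (pick (indicator {i \<in> I. c i \<noteq> d i}) z) \<partial>distr copies copies R)"
    by (simp add: corr_def R)
  also have "\<dots> = (\<integral>z. f (pick (indicator {}) (R z)) * f (pick (indicator {i \<in> I. c i \<noteq> d i}) (R z)) \<partial>copies)"
    by (rule integral_distr[OF R_measurable]) measurable
  also have "\<dots> = (\<integral>z. f (pick c z) * f (pick d z) \<partial>copies)"
  proof -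
    have "pick (indicator {}) (R z) = pick c z" 
      "pick (indicator {i \<in> I. c i \<noteq> d i}) (R z) = pick d z" for z
      by (auto simp: pick_def R_def t_def fun_eq_iff indicator_def)
    then show ?thesis by simp
  qed
  finally show ?thesis ..
qed

text \<open>Let \<open>u = \<Sum>S\<in>F. w S * f(X\<^sup>S)\<close>, and let \<open>u\<^sub>m\<close> be \<open>u\<close> with the coordinates in \<open>A\<close> taken from the
  \<open>m\<close>-th copy. The second moments \<open>E[u\<^sub>m u\<^sub>l]\<close> take one value \<open>s\<close> for \<open>m \<noteq> l\<close>, which is the quadratic
  form below, and one value \<open>d\<close> for \<open>m = l\<close>. Hence \<open>0 \<le> E[(u\<^sub>0 + \<dots> + u\<^sub>k\<^sub>-\<^sub>1)\<^sup>2] = k d + k (k - 1) s\<close>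
  for all \<open>k\<close>, which for large \<open>k\<close> forces \<open>s \<ge> 0\<close>.\<close>

lemma corr_quadratic_form_nonneg:
  fixes w :: "'i set \<Rightarrow> real"
  assumes F: "finite F" "\<And>S. S \<in> F \<Longrightarrow> S \<subseteq> I" and A: "A \<subseteq> I"
  shows "0 \<le> (\<Sum>S\<in>F. \<Sum>T\<in>F. w S * w T * corr (A \<union> sym_diff S T))"
proof -
  define s where "s = (\<Sum>S\<in>F. \<Sum>T\<in>F. w S * w T * corr (A \<union> sym_diff S T))"
  define c where "c m S i = (if i \<in> A then m else indicator S i :: nat)" for m S i
  define d where "d = (\<Sum>S\<in>F. \<Sum>T\<in>F. w S * w T * corr (sym_diff S T - A))"
  have gram: "(\<integral>z. f (pick (c m S) z) * f (pick (c l T) z) \<partial>copies)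
      = (if m = l then corr (sym_diff S T - A) else corr (A \<union> sym_diff S T))"
    if "S \<in> F" "T \<in> F" for m l S T
  proof -
    have "{i \<in> I. c m S i \<noteq> c l T i} = (if m = l then sym_diff S T - A else A \<union> sym_diff S T)"
      using F(2)[OF that(1)] F(2)[OF that(2)] A by (auto simp: c_def indicator_def split: if_splits)
    then show ?thesis by (simp add: integral_pick_mult)
  qed
  have bound: "0 \<le> real k * d + real k * (real k - 1) * s" for k
  proof -
    let ?v = "\<lambda>m S z. w S * f (pick (c m S) z)"
    have "0 \<le> (\<integral>z. (\<Sum>m<k. \<Sum>S\<in>F. ?v m S z)\<^sup>2 \<partial>copies)"
      by simp
    also have "\<dots> = (\<integral>z. (\<Sum>m<k. \<Sum>l<k. \<Sum>S\<in>F. \<Sum>T\<in>F.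
        w S * w T * (f (pick (c m S) z) * f (pick (c l T) z))) \<partial>copies)"
      unfolding power2_eq_square sum_product
      by (intro Bochner_Integration.integral_cong refl sum.cong) (simp only: mult_ac)
    also have "\<dots> = (\<Sum>m<k. \<Sum>l<k. \<Sum>S\<in>F. \<Sum>T\<in>F.
        w S * w T * (\<integral>z. f (pick (c m S) z) * f (pick (c l T) z) \<partial>copies))"
      by (simp only: Bochner_Integration.integral_sum Bochner_Integration.integrable_sum
          integrable_mult_right integrable_pick_mult integral_mult_right_zero)
    also have "\<dots> = (\<Sum>m<k. \<Sum>l<k. if m = l then d else s)"
      by (intro sum.cong refl) (auto simp: gram d_def s_def intro!: sum.cong)
    also have "\<dots> = (\<Sum>m<k. \<Sum>l<k. s + (if m = l then d - s else 0))"
      by (intro sum.cong refl) auto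
    also have "\<dots> = real k * d + real k * (real k - 1) * s"
    proof -
      have "(\<Sum>m<k. \<Sum>l<k. u + (if m = l then d - u else 0)) = real k * d + real k * (real k - 1) * u"
        for u by (simp add: sum.distrib) (simp add: algebra_simps)
      then show ?thesis .
    qed
    finally show ?thesis .
  qed
  have "0 \<le> s"
  proof (rule ccontr)
    assume "\<not> 0 \<le> s"
    then obtain k where k: "d < real k * (- s)"
      using reals_Archimedean3[of "- s"] by auto
    have "0 \<le> real (Suc k) * (d + real k * s)"
      using bound[of "Suc k"] by (simp add: algebra_simps)
    then have "0 \<le> d + real k * s"
      by (simp add: zero_le_mult_iff)
    with k show False by simp
  qed
then show ?thesis by (simp only: s_def)
qed

text \<open>The quadratic form of \<open>u = f(X) - f(X\<^sup>{\<^sup>j\<^sup>})\<close>.\<close>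

lemma corr_insert_le:
  assumes "A \<subseteq> I" "j \<in> I"
  shows "corr (insert j A) \<le> corr A"
proof -
  have "0 \<le> (\<Sum>S\<in>{{}, {j}}. \<Sum>T\<in>{{}, {j}}.
      (if S = {} then 1 else - 1) * (if T = {} then 1 else - 1) * corr (A \<union> sym_diff S T))"
    using assms by (intro corr_quadratic_form_nonneg) auto
  also have "\<dots> = 2 * (corr A - corr (insert j A))"
    by simp
  finally show ?thesis by simp
qed

text \<open>The quadratic form of \<open>u = f(X) - f(X\<^sup>{\<^sup>j\<^sup>}) - f(X\<^sup>{\<^sup>k\<^sup>}) + f(X\<^sup>{\<^sup>j\<^sup>,\<^sup>k\<^sup>})\<close>.\<close>

lemma corr_convex:
  assumes "A \<subseteq> I" "j \<in> I" "k \<in> I" "j \<noteq> k"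
  shows "corr (insert j A) + corr (insert k A) \<le> corr A + corr (insert k (insert j A))"
proof -
  define w :: "'i set \<Rightarrow> real" where "w S = (if S = {} \<or> S = {j, k} then 1 else - 1)" for S
  have sum4: "(\<Sum>S\<in>{{}, {j}, {k}, {j, k}}. g S) = g {} + g {j} + g {k} + g {j, k}"
    for g :: "'i set \<Rightarrow> real"
    using assms(4) by (subst sum.insert; auto)+
  have w: "w {} = 1" "w {j} = - 1" "w {k} = - 1" "w {j, k} = 1"
    using assms(4) by (auto simp: w_def)
  have diffs: "{j, k} - {k} = {j}" "{j, k} - {j} = {k}" "{j} - {k} = {j}" "{k} - {j} = {k}"
      "{j} - {j, k} = {}" "{k} - {j, k} = {}" "A \<union> {k, j} = insert k (insert j A)"
      "A \<union> {j, k} = insert k (insert j A)" "A \<union> {j} = insert j A" "A \<union> {k} = insert k A"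
      "{j} \<union> {k} = {j, k}" "{k} \<union> {j} = {j, k}"
    using assms(4) by auto
  have "0 \<le> (\<Sum>S\<in>{{}, {j}, {k}, {j, k}}. \<Sum>T\<in>{{}, {j}, {k}, {j, k}}.
      w S * w T * corr (A \<union> sym_diff S T))"
    using assms by (intro corr_quadratic_form_nonneg) auto
  also have "\<dots> = 4 * (corr A - corr (insert j A) - corr (insert k A) + corr (insert k (insert j A)))"
    unfolding sum4 w by (simp only: diffs Diff_empty empty_Diff Un_empty_left Un_empty_right Diff_cancel) simp
  finally show ?thesis by simp
qed

text \<open>The following lemmas carry the results from the copies back to a pair \<open>(X, X')\<close> distributed by
  the square of the product measure.\<close>

lemma measurable_override_on:
  assumes "A \<subseteq> I"
  shows "(\<lambda>(x, x'). override_on x x' A) \<in> PiM I N \<Otimes>\<^sub>M PiM I N \<rightarrow>\<^sub>M PiM I N"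
proof -
  let ?choose = "\<lambda>w. \<lambda>i\<in>I. if i \<in> A then snd w i else fst w i"
  have eq: "(\<lambda>(x, x'). override_on x x' A) w = ?choose w"
    if "w \<in> space (PiM I N \<Otimes>\<^sub>M PiM I N)" for w
  proof
    fix i
    have "fst w \<in> space (PiM I N)" "snd w \<in> space (PiM I N)"
      using that by (simp_all add: space_pair_measure mem_Times_iff)
    then have "fst w i = undefined" "snd w i = undefined" if "i \<notin> I"
      using that unfolding space_PiM by (blast dest: PiE_arb)+
    then show "(\<lambda>(x, x'). override_on x x' A) w i = ?choose w i"
      using assms by (cases "i \<in> I") (auto simp: override_on_def case_prod_beta')
  qed
  have "?choose \<in> PiM I N \<Otimes>\<^sub>M PiM I N \<rightarrow>\<^sub>M PiM I N"
  proof (rule measurable_restrict)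
    fix i assume i: "i \<in> I"
    note component = measurable_component_singleton[OF i, of N]
    show "(\<lambda>w. if i \<in> A then snd w i else fst w i) \<in> PiM I N \<Otimes>\<^sub>M PiM I N \<rightarrow>\<^sub>M N i"
      using measurable_compose[OF measurable_fst component] measurable_compose[OF measurable_snd component]
      by (cases "i \<in> A") (simp_all only: if_True if_False)
  qed
  then show ?thesis
    by (rule iffD2[OF measurable_cong[OF eq], rotated])
qed

lemma measurable_f_override_on:
  assumes "A \<subseteq> I"
  shows "(\<lambda>(x, x'). f (override_on x x' A)) \<in> borel_measurable (PiM I N \<Otimes>\<^sub>M PiM I N)"
  using measurable_compose[OF measurable_override_on[OF assms] f_measurable]
  by (simp add: case_prod_beta')

lemma prob_space_copies: "prob_space copies"
  unfolding copies_def using prob_N by (intro prob_space_PiM) auto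

lemma indep_var_pick:
  assumes "I \<noteq> {}"
  shows "prob_space.indep_var copies (PiM I N) (pick (indicator {})) (PiM I N) (pick (indicator I))"
proof -
  interpret prob_space copies by (rule prob_space_copies)
  let ?K = "I \<times> (UNIV :: nat set)"
  let ?N = "\<lambda>k. N (fst k)"
  have rv: "random_variable (N (fst k)) (\<lambda>z. z k)" if "k \<in> ?K" for k
    using that unfolding copies_def by (rule measurable_component_singleton)
  have coordinate: "distr copies (N (fst k)) (\<lambda>z. z k) = N (fst k)" if "k \<in> ?K" for k
    unfolding copies_def using that prob_N by (intro distr_PiM_component) auto
  \<comment> \<open>The coordinates under a product measure are independent, and the two vectors are read off
    disjoint sets of coordinates.\<close>
  have "distr copies (PiM ?K ?N) (\<lambda>z. \<lambda>k\<in>?K. z k) = distr copies copies (\<lambda>z. z)"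
    by (rule distr_cong) (auto simp: copies_def space_PiM PiE_def extensional_restrict)
  also have "\<dots> = (\<Pi>\<^sub>M k\<in>?K. distr copies (N (fst k)) (\<lambda>z. z k))"
    unfolding distr_id2[OF refl] by (subst copies_def, rule PiM_cong) (simp_all add: coordinate)
  finally have joint: "distr copies (PiM ?K ?N) (\<lambda>z. \<lambda>k\<in>?K. z k)
      = (\<Pi>\<^sub>M k\<in>?K. distr copies (N (fst k)) (\<lambda>z. z k))" .
  have nonempty: "?K \<noteq> {}"
    using assms by simp
  have "indep_vars ?N (\<lambda>k z. z k) ?K"
    using joint by (rule iffD2[OF indep_vars_iff_distr_eq_PiM'[OF nonempty rv], rotated -1])
  then have indep: "indep_var
      (PiM (I \<times> {0}) ?N) (\<lambda>z. restrict z (I \<times> {0})) (PiM (I \<times> {1}) ?N) (\<lambda>z. restrict z (I \<times> {1}))"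
    by (rule indep_var_restrict) auto
  have read: "(\<lambda>z. \<lambda>i\<in>I. z (i, m)) \<in> PiM (I \<times> {m}) ?N \<rightarrow>\<^sub>M PiM I N" for m :: nat
  proof (rule measurable_restrict)
    show "(\<lambda>z. z (i, m)) \<in> PiM (I \<times> {m}) ?N \<rightarrow>\<^sub>M N i" if "i \<in> I" for i
      using measurable_component_singleton[of "(i, m)" "I \<times> {m}" ?N] that by simp
  qed
  have "(\<lambda>z. \<lambda>i\<in>I. z (i, 0)) \<circ> (\<lambda>z. restrict z (I \<times> {0})) = pick (indicator {})"
    "(\<lambda>z. \<lambda>i\<in>I. z (i, 1)) \<circ> (\<lambda>z. restrict z (I \<times> {1})) = pick (indicator I)"
    by (auto simp: pick_def fun_eq_iff)
  with indep_var_compose[OF indep read read] show ?thesis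
    by (simp only:)
qed

lemma distr_pick_pair:
  assumes "I \<noteq> {}"
  shows "distr copies (PiM I N \<Otimes>\<^sub>M PiM I N) (\<lambda>z. (pick (indicator {}) z, pick (indicator I) z))
    = PiM I N \<Otimes>\<^sub>M PiM I N"
  using indep_var_pick[OF assms]
  unfolding prob_space.indep_var_distribution_eq[OF prob_space_copies] distr_pick by (elim conjE) (rule sym)

lemma override_on_pick:
  "A \<subseteq> I \<Longrightarrow> override_on (pick (indicator {}) z) (pick (indicator I) z) A = pick (indicator A) z"
  by (auto simp: pick_def override_on_def fun_eq_iff)

text \<open>Of the four products of values of \<open>f\<close>, the two positive ones compare vectors that differ in the
  copies used on \<open>A\<close>, the two negative ones vectors that differ on \<open>insert j A\<close>.\<close>

lemma has_bochner_integral_increments: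
  assumes "A \<subseteq> I" "j \<in> I" "j \<notin> A"
  shows "has_bochner_integral (PiM I N \<Otimes>\<^sub>M PiM I N)
    (\<lambda>(x, x'). (f x - f (x(j := x' j))) * (f (override_on x x' A) - f (override_on x x' (insert j A))))
    (2 * (corr A - corr (insert j A)))"
proof -
  let ?PP = "PiM I N \<Otimes>\<^sub>M PiM I N"
  let ?g = "\<lambda>(x, x'). (f x - f (x(j := x' j))) *
    (f (override_on x x' A) - f (override_on x x' (insert j A)))"
  let ?pair = "\<lambda>z. (pick (indicator {}) z, pick (indicator I) z)"
  let ?F = "\<lambda>S z. f (pick (indicator S) z)"
  have sub: "insert j A \<subseteq> I" "{j} \<subseteq> I"
    using assms by auto
  have upd: "x(j := x' j) = override_on x x' {j}" for x x' :: "'i \<Rightarrow> 'b"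
    by (auto simp: override_on_def)
  have g_measurable: "?g \<in> borel_measurable ?PP"
    using measurable_f_override_on[of "{}"] measurable_f_override_on[OF sub(2)]
      measurable_f_override_on[OF assms(1)] measurable_f_override_on[OF sub(1)]
    unfolding upd case_prod_beta' by auto
  have pull: "?g (?pair z) = ?F {} z * ?F A z - ?F {} z * ?F (insert j A) z
      - ?F {j} z * ?F A z + ?F {j} z * ?F (insert j A) z" for z
    using assms sub by (simp add: upd override_on_pick algebra_simps)
  have gram: "(\<integral>z. ?F S z * ?F T z \<partial>copies) = corr (sym_diff S T)" if "S \<subseteq> I" "T \<subseteq> I" for S T
  proof -
    have "{i \<in> I. indicator S i \<noteq> (indicator T i :: nat)} = sym_diff S T"
      using that by (auto simp: indicator_def split: if_splits)
    then show ?thesis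
      by (simp add: integral_pick_mult)
  qed
  have "sym_diff {j} A = insert j A" "sym_diff {j} (insert j A) = A"
    using assms by auto
  then have "has_bochner_integral copies (\<lambda>z. ?g (?pair z)) (2 * (corr A - corr (insert j A)))"
    unfolding has_bochner_integral_iff pull
    using gram[of "{}" A] gram[of "{}" "insert j A"] gram[of "{j}" A] gram[of "{j}" "insert j A"] assms sub
    by (simp add: integrable_pick_mult)
  moreover have "?pair \<in> copies \<rightarrow>\<^sub>M ?PP"
    by measurable
  moreover have "?PP = distr copies ?PP ?pair"
    using distr_pick_pair assms(2) by (intro sym[OF distr_pick_pair]) auto
  ultimately show ?thesis
    using has_bochner_integral_distr[of ?g ?PP ?pair copies] g_measurable by auto
qed

lemma corr_empty: "corr {} = (\<integral>x. (f x)\<^sup>2 \<partial>PiM I N)"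
proof -
  have "(\<integral>x. (f x)\<^sup>2 \<partial>PiM I N) = (\<integral>x. (f x)\<^sup>2 \<partial>distr copies (PiM I N) (pick (indicator {})))"
    by (simp add: distr_pick)
  also have "\<dots> = (\<integral>z. (f (pick (indicator {}) z))\<^sup>2 \<partial>copies)"
    using f_measurable by (intro integral_distr) auto
  finally show ?thesis
    by (simp add: corr_def power2_eq_square)
qed

lemma corr_all:
  assumes "I \<noteq> {}"
  shows "corr I = (\<integral>x. f x \<partial>PiM I N)\<^sup>2"
proof -
  interpret prob_space copies by (rule prob_space_copies)
  have mean: "(\<integral>z. f (pick c z) \<partial>copies) = (\<integral>x. f x \<partial>PiM I N)" for c
    using integral_distr[OF measurable_pick f_measurable, of c] by (simp add: distr_pick)
  have integrable: "integrable copies (\<lambda>z. f (pick c z))" for c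
    by (rule square_integrable_imp_integrable) (use integrable_pick_square in auto)
  have "indep_var borel (\<lambda>z. f (pick (indicator {}) z)) borel (\<lambda>z. f (pick (indicator I) z))"
    using indep_var_compose[OF indep_var_pick[OF assms] f_measurable f_measurable]
    by (simp add: comp_def)
  from indep_var_lebesgue_integral[OF this integrable integrable] show ?thesis
    by (simp add: corr_def mean power2_eq_square)
qed

end

section \<open>Averages over a uniform random permutation\<close>

definition prefix_mean :: "nat \<Rightarrow> (nat set \<Rightarrow> real) \<Rightarrow> nat \<Rightarrow> real" where
  "prefix_mean n \<phi> k = (\<Sum>p | p permutes {1..n}. \<phi> (p ` {1..k})) / fact n"

lemma prefix_mean_0: "prefix_mean n \<phi> 0 = \<phi> {}"
  by (simp add: prefix_mean_def card_permutations[OF refl])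

lemma prefix_mean_all: "prefix_mean n \<phi> n = \<phi> {1..n}"
  by (simp add: prefix_mean_def permutes_image card_permutations[OF refl])

lemma prefix_mean_Suc_le:
  assumes "\<And>A j. A \<subseteq> {1..n} \<Longrightarrow> j \<in> {1..n} \<Longrightarrow> \<phi> (insert j A) \<le> \<phi> A" and "k < n"
  shows "prefix_mean n \<phi> (Suc k) \<le> prefix_mean n \<phi> k"
  unfolding prefix_mean_def
proof (intro divide_right_mono sum_mono)
  fix p assume "p \<in> {p. p permutes {1..n}}"
  then have p: "p permutes {1..n}" by simp
  have "p ` {1..k} \<subseteq> p ` {1..n}"
    using assms(2) by (intro image_mono) auto
  then have "p ` {1..k} \<subseteq> {1..n}"
    by (simp only: permutes_image[OF p])
  moreover have "p (Suc k) \<in> {1..n}"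
    unfolding permutes_in_image[OF p] using assms(2) by auto
  ultimately show "\<phi> (p ` {1..Suc k}) \<le> \<phi> (p ` {1..k})"
    using assms(1) by (simp add: atLeastAtMostSuc_conv)
qed simp

text \<open>Composing \<open>p\<close> with the transposition of \<open>k + 1\<close> and \<open>k + 2\<close> permutes the summands, so the mean for
  \<open>k + 1\<close> is also the mean of \<open>\<phi>\<close> over \<open>p([k]) \<union> {p(k + 2)}\<close>. Averaging the two expressions turns
  convexity of \<open>\<phi>\<close> at \<open>p([k])\<close> into convexity in \<open>k\<close>.\<close>

lemma prefix_mean_convex:
  assumes convex: "\<And>A i j. A \<subseteq> {1..n} \<Longrightarrow> i \<in> {1..n} \<Longrightarrow> j \<in> {1..n} \<Longrightarrow> i \<noteq> j \<Longrightarrow>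
      \<phi> (insert i A) + \<phi> (insert j A) \<le> \<phi> A + \<phi> (insert j (insert i A))"
    and k: "Suc (Suc k) \<le> n"
  shows "2 * prefix_mean n \<phi> (Suc k) \<le> prefix_mean n \<phi> k + prefix_mean n \<phi> (Suc (Suc k))"
proof -
  let ?S = "{p. p permutes {1..n}}"
  let ?t = "Transposition.transpose (Suc k) (Suc (Suc k))"
  have t: "?t permutes {1..n}"
    using k by (intro permutes_swap_id) auto
  have "?t ` {1..Suc k} = insert (Suc (Suc k)) {1..k}"
    by (auto simp: atLeastAtMostSuc_conv image_iff Transposition.transpose_def)
  then have "(p \<circ> ?t) ` {1..Suc k} = insert (p (Suc (Suc k))) (p ` {1..k})" for p :: "nat \<Rightarrow> nat"
    by (simp only: image_comp[symmetric] image_insert)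
  then have swap: "(\<Sum>p\<in>?S. \<phi> (p ` {1..Suc k})) = (\<Sum>p\<in>?S. \<phi> (insert (p (Suc (Suc k))) (p ` {1..k})))"
    by (subst sum_permutations_compose_right[OF t]) (simp only:)
  have "2 * (\<Sum>p\<in>?S. \<phi> (p ` {1..Suc k}))
      = (\<Sum>p\<in>?S. \<phi> (p ` {1..Suc k}) + \<phi> (insert (p (Suc (Suc k))) (p ` {1..k})))"
    by (simp only: sum.distrib swap[symmetric])
  also have "\<dots> \<le> (\<Sum>p\<in>?S. \<phi> (p ` {1..k}) + \<phi> (p ` {1..Suc (Suc k)}))"
  proof (intro sum_mono)
    fix p assume "p \<in> ?S"
    then have p: "p permutes {1..n}" by simp
    have "p ` {1..k} \<subseteq> p ` {1..n}"
      using k by (intro image_mono) auto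
    then have "p ` {1..k} \<subseteq> {1..n}"
      by (simp only: permutes_image[OF p])
    moreover have "p (Suc k) \<in> {1..n}" "p (Suc (Suc k)) \<in> {1..n}"
      unfolding permutes_in_image[OF p] using k by auto
    moreover have "p (Suc k) \<noteq> p (Suc (Suc k))"
      using permutes_inj[OF p] by (simp add: inj_eq)
    ultimately show "\<phi> (p ` {1..Suc k}) + \<phi> (insert (p (Suc (Suc k))) (p ` {1..k}))
        \<le> \<phi> (p ` {1..k}) + \<phi> (p ` {1..Suc (Suc k)})"
      using convex[of "p ` {1..k}" "p (Suc k)" "p (Suc (Suc k))"]
      by (simp add: atLeastAtMostSuc_conv)
  qed
  finally show ?thesis
    by (simp add: prefix_mean_def sum.distrib add_divide_distrib[symmetric] divide_right_mono)
qed

context prob_space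
begin

lemma indep_rv_compose:
  assumes "indep_rv S X T Y" "g \<in> S \<rightarrow>\<^sub>M S'" "h \<in> T \<rightarrow>\<^sub>M T'"
  shows "indep_rv S' (\<lambda>\<omega>. g (X \<omega>)) T' (\<lambda>\<omega>. h (Y \<omega>))"
proof -
  have rv: "random_variable S X" "random_variable T Y"
    using assms(1) by (auto simp: indep_rv_def)
  have preimages: "sigma_sets (space M) {(\<lambda>\<omega>. u (Z \<omega>)) -` A \<inter> space M | A. A \<in> sets U'}
      \<subseteq> sigma_sets (space M) {Z -` A \<inter> space M | A. A \<in> sets U}"
    if Z: "Z \<in> M \<rightarrow>\<^sub>M U" and u: "u \<in> U \<rightarrow>\<^sub>M U'" for Z :: "'a \<Rightarrow> 'x" and U and u :: "'x \<Rightarrow> 'y" and U'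
  proof (rule sigma_sets_mono', safe)
    fix A assume "A \<in> sets U'"
    then have "u -` A \<inter> space U \<in> sets U"
      using u by (rule measurable_sets[rotated])
    moreover have "(\<lambda>\<omega>. u (Z \<omega>)) -` A \<inter> space M = Z -` (u -` A \<inter> space U) \<inter> space M"
      using measurable_space[OF Z] by auto
    ultimately show "\<exists>C. (\<lambda>\<omega>. u (Z \<omega>)) -` A \<inter> space M = Z -` C \<inter> space M \<and> C \<in> sets U"
      by blast
  qed
  show ?thesis
    unfolding indep_rv_def indep_set_def
  proof (intro conjI)
    show "random_variable S' (\<lambda>\<omega>. g (X \<omega>))" "random_variable T' (\<lambda>\<omega>. h (Y \<omega>))"
      using rv assms(2,3) by (auto intro: measurable_compose)
    show "indep_sets (case_bool
        (sigma_sets (space M) {(\<lambda>\<omega>. g (X \<omega>)) -` A \<inter> space M | A. A \<in> sets S'})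
        (sigma_sets (space M) {(\<lambda>\<omega>. h (Y \<omega>)) -` A \<inter> space M | A. A \<in> sets T'})) UNIV"
    proof (rule indep_sets_mono_sets)
      show "indep_sets (case_bool
          (sigma_sets (space M) {X -` A \<inter> space M | A. A \<in> sets S})
          (sigma_sets (space M) {Y -` A \<inter> space M | A. A \<in> sets T})) UNIV"
        using assms(1) by (simp add: indep_rv_def indep_set_def)
    qed (use preimages[OF rv(1) assms(2)] preimages[OF rv(2) assms(3)] in \<open>auto split: bool.split\<close>)
  qed
qed

text \<open>Splitting according to the value of \<open>\<sigma>\<close>, each event \<open>\<sigma> = p\<close> is independent of \<open>Y\<close> and has
  probability \<open>1 / card S\<close>.\<close>

lemma expectation_uniform_index:
  fixes h :: "'c \<Rightarrow> 'd \<Rightarrow> real"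
  assumes S: "finite S" "S \<noteq> {}"
    and uniform: "distr M (count_space S) \<sigma> = uniform_count_measure S"
    and indep: "indep_rv (count_space S) \<sigma> T Y"
    and h: "\<And>p. p \<in> S \<Longrightarrow> h p \<in> borel_measurable T" "\<And>p. p \<in> S \<Longrightarrow> integrable M (\<lambda>\<omega>. h p (Y \<omega>))"
  shows "expectation (\<lambda>\<omega>. h (\<sigma> \<omega>) (Y \<omega>)) = (\<Sum>p\<in>S. expectation (\<lambda>\<omega>. h p (Y \<omega>))) / real (card S)"
proof -
  have \<sigma>: "\<sigma> \<in> M \<rightarrow>\<^sub>M count_space S"
    using indep by (simp add: indep_rv_def)
  let ?e = "\<lambda>p \<omega>. indicator {p} (\<sigma> \<omega>) :: real"
  have e: "integrable M (?e p)" "expectation (?e p) = 1 / real (card S)" if "p \<in> S" for p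
  proof -
    have "(indicator {p} :: 'c \<Rightarrow> real) \<in> borel_measurable (count_space S)"
      by simp
    note meas = measurable_compose[OF \<sigma> this] and integral_distr[OF \<sigma> this]
    show "integrable M (?e p)"
      by (rule integrable_const_bound[where B = 1]) (use meas in auto)
    have "expectation (?e p) = (\<integral>x. indicator {p} x \<partial>uniform_count_measure S)"
      using integral_distr[OF \<sigma>, of "indicator {p} :: 'c \<Rightarrow> real"] by (simp add: uniform)
    also have "\<dots> = measure (uniform_count_measure S) {p}"
      using that by (simp add: space_uniform_count_measure Int_absorb2)
    also have "\<dots> = 1 / real (card S)"
      using that S by (subst measure_uniform_count_measure) auto
    finally show "expectation (?e p) = 1 / real (card S)" .
  qed
  have product: "integrable M (\<lambda>\<omega>. ?e p \<omega> * h p (Y \<omega>))"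
    "expectation (\<lambda>\<omega>. ?e p \<omega> * h p (Y \<omega>)) = expectation (\<lambda>\<omega>. h p (Y \<omega>)) / real (card S)"
    if p: "p \<in> S" for p
  proof -
    have "indep_var borel (?e p) borel (\<lambda>\<omega>. h p (Y \<omega>))"
      unfolding indep_rv_eq_indep_var[symmetric]
      by (rule indep_rv_compose[OF indep]) (use h(1)[OF p] in simp_all)
    note indep_var_integrable[OF this e(1)[OF p] h(2)[OF p]]
      indep_var_lebesgue_integral[OF this e(1)[OF p] h(2)[OF p]]
    then show "integrable M (\<lambda>\<omega>. ?e p \<omega> * h p (Y \<omega>))"
      "expectation (\<lambda>\<omega>. ?e p \<omega> * h p (Y \<omega>)) = expectation (\<lambda>\<omega>. h p (Y \<omega>)) / real (card S)"
      by (simp_all add: e(2)[OF p])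
  qed
  have "h (\<sigma> \<omega>) (Y \<omega>) = (\<Sum>p\<in>S. ?e p \<omega> * h p (Y \<omega>))" if "\<omega> \<in> space M" for \<omega>
  proof -
    have "\<sigma> \<omega> \<in> S"
      using measurable_space[OF \<sigma> that] by simp
    have "(\<Sum>p\<in>S. ?e p \<omega> * h p (Y \<omega>)) = (\<Sum>p\<in>S. if p = \<sigma> \<omega> then h p (Y \<omega>) else 0)"
      by (intro sum.cong) auto
    with \<open>\<sigma> \<omega> \<in> S\<close> S(1) show ?thesis by simp
  qed
  then have "expectation (\<lambda>\<omega>. h (\<sigma> \<omega>) (Y \<omega>)) = expectation (\<lambda>\<omega>. \<Sum>p\<in>S. ?e p \<omega> * h p (Y \<omega>))"
    by (intro Bochner_Integration.integral_cong) auto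
  also have "\<dots> = (\<Sum>p\<in>S. expectation (\<lambda>\<omega>. ?e p \<omega> * h p (Y \<omega>)))"
    by (rule Bochner_Integration.integral_sum) (rule product(1))
  also have "\<dots> = (\<Sum>p\<in>S. expectation (\<lambda>\<omega>. h p (Y \<omega>))) / real (card S)"
    by (simp add: product(2) sum_divide_distrib)
  finally show ?thesis .
qed

end

section \<open>Monotonicity and the variance bound\<close>

theorem lemma2:
  fixes M :: "'a measure" and E :: "'b measure" and n :: nat
    and X X' :: "nat \<Rightarrow> 'a \<Rightarrow> 'b" and \<sigma> :: "'a \<Rightarrow> nat \<Rightarrow> nat" and f :: "(nat \<Rightarrow> 'b) \<Rightarrow> real"
  assumes "prob_space M"
    and "n \<ge> 1"
    and "prob_space.indep_vars M (\<lambda>_. E) X {1..n}"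
    and "prob_space.indep_copy M (\<Pi>\<^sub>M i\<in>{1..n}. E) (rvec n X) (rvec n X')"
    and "f \<in> borel_measurable (\<Pi>\<^sub>M i\<in>{1..n}. E)"
    and "integrable M (\<lambda>\<omega>. (f (rvec n X \<omega>))\<^sup>2)"
    and "prob_space.uniform_permutation M n \<sigma>"
    and "prob_space.indep_rv M
           (count_space {p. p permutes {1..n}}) \<sigma>
           ((\<Pi>\<^sub>M i\<in>{1..n}. E) \<Otimes>\<^sub>M (\<Pi>\<^sub>M i\<in>{1..n}. E)) (\<lambda>\<omega>. (rvec n X \<omega>, rvec n X' \<omega>))"
  shows "(\<forall>i\<in>{1..n - 1}. prob_space.B M n X X' \<sigma> f i \<ge> prob_space.B M n X X' \<sigma> f (i + 1)) \<and>
         prob_space.B M n X X' \<sigma> f n \<ge> 0 \<and>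
         (\<forall>k\<in>{1..n}. prob_space.B M n X X' \<sigma> f k
            \<le> 2 * prob_space.variance M (\<lambda>\<omega>. f (rvec n X \<omega>)) / real k)"
proof -
  interpret prob_space M by fact
  let ?I = "{1..n}"
  let ?E = "\<Pi>\<^sub>M i\<in>?I. E"
  let ?S = "{p. p permutes ?I}"
  define N where "N i = distr M E (X i)" for i
  have nonempty: "?I \<noteq> {}"
    using assms(2) by simp
  have X: "random_variable E (X i)" if "i \<in> ?I" for i
    using assms(3) that by (auto simp: indep_vars_def)
  have sets_N: "sets (PiM ?I N) = sets ?E"
    by (intro sets_PiM_cong) (simp_all add: N_def)
  have law: "distr M ?E (rvec n X) = PiM ?I N"
    using assms(3) indep_vars_iff_distr_eq_PiM'[OF nonempty X, of "\<lambda>i. i"]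
    by (simp add: rvec_def[abs_def] N_def[abs_def])
  have indep: "indep_var ?E (rvec n X) ?E (rvec n X')" and law': "distr M ?E (rvec n X') = PiM ?I N"
    using assms(4) law by (simp_all add: indep_copy_def)
  have rv: "random_variable ?E (rvec n X)" "random_variable (?E \<Otimes>\<^sub>M ?E) (\<lambda>\<omega>. (rvec n X \<omega>, rvec n X' \<omega>))"
    using indep_var_rv1[OF indep] indep_var_rv2[OF indep] by auto
  have joint_law: "distr M (?E \<Otimes>\<^sub>M ?E) (\<lambda>\<omega>. (rvec n X \<omega>, rvec n X' \<omega>)) = PiM ?I N \<Otimes>\<^sub>M PiM ?I N"
    using indep unfolding indep_var_distribution_eq law law' by (elim conjE) (rule sym)
  have integral_law: "(\<integral>x. g x \<partial>PiM ?I N) = expectation (\<lambda>\<omega>. g (rvec n X \<omega>))"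
    if "g \<in> borel_measurable ?E" for g :: "(nat \<Rightarrow> 'b) \<Rightarrow> real"
    using integral_distr[OF rv(1) that] by (simp only: law)

  interpret resampling ?I N f
  proof (rule resampling.intro)
    show "prob_space (N i)" if "i \<in> ?I" for i
      unfolding N_def by (rule prob_space_distr) (rule X[OF that])
    show "f \<in> borel_measurable (PiM ?I N)"
      using assms(5) by (subst measurable_cong_sets[OF sets_N refl])
    show "integrable (PiM ?I N) (\<lambda>x. (f x)\<^sup>2)"
      unfolding law[symmetric] using assms(5,6) rv(1) by (subst integrable_distr_eq) auto
  qed

  let ?a = "prefix_mean n corr"
  have B_eq: "B n X X' \<sigma> f i = 2 * (?a (i - 1) - ?a i)" if i: "i \<in> ?I" for i
  proof -
    define h where "h p = (\<lambda>(x, x'). (f x - f (x(p i := x' (p i)))) *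
      (f (override_on x x' (p ` {1..i - 1})) - f (override_on x x' (p ` {1..i}))))" for p :: "nat \<Rightarrow> nat"
    let ?Y = "\<lambda>\<omega>. (rvec n X \<omega>, rvec n X' \<omega>)"
    have h: "has_bochner_integral (PiM ?I N \<Otimes>\<^sub>M PiM ?I N) (h p)
        (2 * (corr (p ` {1..i - 1}) - corr (p ` {1..i})))" if "p \<in> ?S" for p
    proof -
      have p: "p permutes ?I"
        using that by simp
      have prefix: "{1..i} = insert i {1..i - 1}"
        using i by auto
      have "p ` {1..i - 1} \<subseteq> p ` ?I"
        using i by (intro image_mono) auto
      then have "p ` {1..i - 1} \<subseteq> ?I" "p i \<in> ?I"
        using i by (simp_all only: permutes_image[OF p] permutes_in_image[OF p])
      moreover have "p i \<notin> p ` {1..i - 1}"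
        using permutes_inj[OF p] i by (auto simp: inj_eq)
      ultimately show ?thesis
        unfolding h_def prefix image_insert by (rule has_bochner_integral_increments)
    qed
    have h_measurable: "h p \<in> borel_measurable (?E \<Otimes>\<^sub>M ?E)" if "p \<in> ?S" for p
      using borel_measurable_has_bochner_integral[OF h[OF that]]
      by (subst measurable_cong_sets[OF sets_pair_measure_cong[OF sets_N[symmetric] sets_N[symmetric]] refl])
    have hY: "has_bochner_integral M (\<lambda>\<omega>. h p (?Y \<omega>))
        (2 * (corr (p ` {1..i - 1}) - corr (p ` {1..i})))" if "p \<in> ?S" for p
      using h[OF that] h_measurable[OF that] rv(2) unfolding joint_law[symmetric]
      by (simp add: has_bochner_integral_iff integral_distr integrable_distr_eq)
    have "B n X X' \<sigma> f i = expectation (\<lambda>\<omega>. h (\<sigma> \<omega>) (?Y \<omega>))"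
      by (simp add: B_def h_def Let_def)
    also have "\<dots> = (\<Sum>p\<in>?S. expectation (\<lambda>\<omega>. h p (?Y \<omega>))) / real (card ?S)"
    proof (rule expectation_uniform_index)
      show "finite ?S"
        by (simp add: finite_permutations)
      show "?S \<noteq> {}"
        using permutes_id by blast
      show "distr M (count_space ?S) \<sigma> = uniform_count_measure ?S"
        using assms(7) by (simp add: uniform_permutation_def)
      show "indep_rv (count_space ?S) \<sigma> (?E \<Otimes>\<^sub>M ?E) ?Y"
        by fact
      show "integrable M (\<lambda>\<omega>. h p (?Y \<omega>))" if "p \<in> ?S" for p
        using hY[OF that] by (simp add: has_bochner_integral_iff)
    qed (rule h_measurable)
    also have "(\<Sum>p\<in>?S. expectation (\<lambda>\<omega>. h p (?Y \<omega>)))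
        = (\<Sum>p\<in>?S. 2 * (corr (p ` {1..i - 1}) - corr (p ` {1..i})))"
      by (intro sum.cong refl) (rule has_bochner_integral_integral_eq[OF hY])
    also have "\<dots> / real (card ?S) = 2 * (?a (i - 1) - ?a i)"
      by (simp only: prefix_mean_def card_permutations[OF refl] finite_atLeastAtMost card_atLeastAtMost
          sum_distrib_left[symmetric] sum_subtractf diff_divide_distrib[symmetric]) simp
    finally show ?thesis .
  qed

  have a_decreasing: "?a (Suc k) \<le> ?a k" if "k < n" for k
    using corr_insert_le that by (rule prefix_mean_Suc_le)
  have a_convex: "2 * ?a (Suc k) \<le> ?a k + ?a (Suc (Suc k))" if "Suc (Suc k) \<le> n" for k
    using corr_convex that by (rule prefix_mean_convex)
  have a_last: "?a n \<le> ?a k" if "k \<le> n" for k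
    using that by (induction rule: inc_induct) (use a_decreasing in \<open>force intro: order_trans\<close>)+

  have decreasing: "B n X X' \<sigma> f (i + 1) \<le> B n X X' \<sigma> f i" if "i \<in> {1..n - 1}" for i
  proof -
    have "1 \<le> i" "Suc i \<le> n"
      using that by auto
    then show ?thesis
      using a_convex[of "i - 1"] B_eq[of i] B_eq[of "i + 1"] by simp
  qed
  have nonneg: "0 \<le> B n X X' \<sigma> f n"
    using assms(2) a_decreasing[of "n - 1"] B_eq[of n] by auto

  have variance: "variance (\<lambda>\<omega>. f (rvec n X \<omega>)) = ?a 0 - ?a n"
  proof -
    have f_rvec: "(\<lambda>\<omega>. f (rvec n X \<omega>)) \<in> borel_measurable M"
      using measurable_compose[OF rv(1) assms(5)] .
    have "integrable M (\<lambda>\<omega>. f (rvec n X \<omega>))"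
      by (rule square_integrable_imp_integrable[OF f_rvec assms(6)])
    then have "variance (\<lambda>\<omega>. f (rvec n X \<omega>))
        = expectation (\<lambda>\<omega>. (f (rvec n X \<omega>))\<^sup>2) - (expectation (\<lambda>\<omega>. f (rvec n X \<omega>)))\<^sup>2"
      using assms(6) by (rule variance_eq)
    moreover have "(\<lambda>x. (f x)\<^sup>2) \<in> borel_measurable ?E"
      using assms(5) by simp
    ultimately show ?thesis
      by (simp only: prefix_mean_0 prefix_mean_all corr_empty corr_all[OF nonempty]
          integral_law[OF assms(5)] integral_law)
  qed
  \<comment> \<open>\<open>B k\<close> is the smallest of \<open>B 1, \<dots>, B k\<close>, whose sum telescopes.\<close>
  have "B n X X' \<sigma> f k \<le> 2 * variance (\<lambda>\<omega>. f (rvec n X \<omega>)) / real k" if k: "k \<in> ?I" for k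
  proof -
    have "B n X X' \<sigma> f k \<le> B n X X' \<sigma> f i" if "i \<in> {1..k}" for i
    proof -
      have "i \<le> k" using that by simp
      then show ?thesis
        using that
      proof (induction rule: inc_induct)
        case (step m)
        then show ?case
          using decreasing[of m] k by force
      qed simp
    qed
    then have "real k * B n X X' \<sigma> f k \<le> (\<Sum>i=1..k. B n X X' \<sigma> f i)"
      using sum_bounded_below[of "{1..k}" "B n X X' \<sigma> f k" "B n X X' \<sigma> f"] by simp
    also have "\<dots> = (\<Sum>i=1..k. 2 * (?a (i - 1) - ?a i))"
      using k by (intro sum.cong refl B_eq) auto
    also have "\<dots> = 2 * (?a 0 - ?a k)"
      by (induction k) simp_all
    also have "\<dots> \<le> 2 * variance (\<lambda>\<omega>. f (rvec n X \<omega>))"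
      using a_last[of k] k by (simp add: variance)
    finally show ?thesis
      using k by (simp add: field_simps)
  qed
  with decreasing nonneg show ?thesis
    by blast
qed

end
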